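(* For $n\geq 1$ let $m_{\max}(n)$ be the maximum number of tangency points that a packing of $n$ horospheres in $\mathbb{H}^3$ may have. Then $$\limsup_{n\to\infty}\frac{m_{\max}(n)}{n}\in[4,5].$$
   Context: A horosphere packing is a finite, connected set of distinct horospheres in hyperbolic space $\mathbb{H}^3$ (i.e. the union of the horospheres is connected) such that any two of the horospheres are either disjoint or tangent. Its number of tangency points is the number of unordered pairs of horospheres which are tangent. *)

theory Defs
  imports "HOL-Analysis.Analysis"
begin

text \<open>
  Hyperbolic 3-space is represented by the upper half-space model; its topology is the
  Euclidean one.  The boundary at infinity is the plane \<open>t = 0\<close>, identified with the
  complex numbers, together with one further point \<open>\<infinity>\<close>.
\<close>

definition hyp3 :: "(complex \<times> real) set" where
  "hyp3 = {(z, t). t > 0}"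

text \<open>
  A horosphere based at a finite point \<open>z\<close> is a Euclidean sphere in the closed half-space
  touching the boundary plane at \<open>(z, 0)\<close>, without this point of contact; the horospheres
  based at \<open>\<infinity>\<close> are the horizontal planes.  The product type carries the Euclidean
  distance, so \<^const>\<open>sphere\<close> is the round sphere.
\<close>

definition horosphere :: "(complex \<times> real) set \<Rightarrow> bool" where
  "horosphere S \<longleftrightarrow>
     (\<exists>z r. r > 0 \<and> S = sphere (z, r) r \<inter> hyp3) \<or>
     (\<exists>h. h > 0 \<and> S = {(z, t). t = h})"

text \<open>
  Tangency takes place inside hyperbolic space: two distinct horospheres based at the same
  point at infinity are disjoint, not tangent.
\<close>

definition tangent :: "(complex \<times> real) set \<Rightarrow> (complex \<times> real) set \<Rightarrow> bool" where
  "tangent S T \<longleftrightarrow> (\<exists>p. S \<inter> T = {p})"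

definition horosphere_packing :: "(complex \<times> real) set set \<Rightarrow> bool" where
  "horosphere_packing P \<longleftrightarrow>
     finite P \<and> (\<forall>S\<in>P. horosphere S) \<and> connected (\<Union>P) \<and>
     (\<forall>S\<in>P. \<forall>T\<in>P. S \<noteq> T \<longrightarrow> disjnt S T \<or> tangent S T)"

definition num_tangencies :: "(complex \<times> real) set set \<Rightarrow> nat" where
  "num_tangencies P = card {{S, T} |S T. S \<in> P \<and> T \<in> P \<and> S \<noteq> T \<and> tangent S T}"

definition m_max :: "nat \<Rightarrow> nat" where
  "m_max n = Max {num_tangencies P |P. horosphere_packing P \<and> card P = n}"

end

theory Submission
  imports Defs
begin

text \<open>
  Lower bound: the balls of radius 1 sitting on the vertices of a hexagonal lattice touch six
  neighbours each and also the horizontal plane at height 2, which gives about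
  \<open>3 n + n\<close> tangencies.

  Upper bound: unless all horospheres are horizontal planes, which are never tangent, some
  horosphere has at most five neighbours, and one removes it and iterates.  Among the horospheres
  based at finite points take one of least Euclidean radius \<open>r\<close> and, for this \<open>r\<close>, with lowest
  base point in the complex plane.  Two neighbours of radii \<open>a r\<close> and \<open>b r\<close> are seen from its base
  point under an angle \<open>\<theta>\<close> with \<open>cos \<theta> \<le> (a + b - a b) / (2 sqrt (a b)) \<le> 1 / 2\<close>, with strict
  inequality if \<open>a > 1\<close>.  If one neighbour is strictly larger, the angles of the others measured
  from it lie strictly between \<open>\<pi> / 3\<close> and \<open>5 \<pi> / 3\<close>, so that there are at most four others, and
  no plane can touch the small horosphere.  If all neighbouring spheres have radius \<open>r\<close>, they lie
  in a half-plane, so that there are at most four of them, and possibly one plane.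
\<close>

section \<open>Horospheres in the half-space model\<close>

definition sphere_horosphere :: "complex \<Rightarrow> real \<Rightarrow> (complex \<times> real) set" where
  "sphere_horosphere z r = sphere (z, r) r \<inter> hyp3"

definition plane_horosphere :: "real \<Rightarrow> (complex \<times> real) set" where
  "plane_horosphere h = {(z, t). t = h}"

lemma horosphere_cases:
  assumes "horosphere S"
  obtains (sphere) z r where "r > 0" "S = sphere_horosphere z r"
  | (plane) h where "h > 0" "S = plane_horosphere h"
  using assms unfolding horosphere_def sphere_horosphere_def plane_horosphere_def by blast

lemma horosphere_sphere: "r > 0 \<Longrightarrow> horosphere (sphere_horosphere z r)"
  unfolding horosphere_def sphere_horosphere_def by blast

lemma horosphere_plane: "h > 0 \<Longrightarrow> horosphere (plane_horosphere h)"
  unfolding horosphere_def plane_horosphere_def by blast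

lemma mem_plane_horosphere [simp]: "(w, t) \<in> plane_horosphere h \<longleftrightarrow> t = h"
  by (simp add: plane_horosphere_def)

text \<open>Expanding the squared distance to the centre cancels \<open>r^2\<close>; the condition
  \<open>t > 0\<close> excludes the point at infinity \<open>(z, 0)\<close>, which also solves the
  equation.\<close>

lemma mem_sphere_horosphere:
  assumes "r > 0"
  shows "(w, t) \<in> sphere_horosphere z r \<longleftrightarrow> t > 0 \<and> (cmod (w - z))\<^sup>2 + t\<^sup>2 = 2 * r * t"
proof -
  have "(w, t) \<in> sphere (z, r) r \<longleftrightarrow> sqrt ((cmod (w - z))\<^sup>2 + (t - r)\<^sup>2) = r"
    by (simp only: mem_sphere dist_commute[of "(z, r)"]) (simp add: dist_norm norm_Pair)
  also have "\<dots> \<longleftrightarrow> (cmod (w - z))\<^sup>2 + (t - r)\<^sup>2 = r\<^sup>2"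
    using assms by (smt (verit) real_sqrt_pow2 real_sqrt_unique sum_power2_ge_zero)
  also have "\<dots> \<longleftrightarrow> (cmod (w - z))\<^sup>2 + t\<^sup>2 = 2 * r * t"
    by (simp add: power2_eq_square algebra_simps)
  finally show ?thesis
    by (auto simp: sphere_horosphere_def hyp3_def)
qed

text \<open>Each sphere contains the top point of the other; adding the two resulting equations
  leaves a vanishing sum of squares.\<close>

lemma sphere_horosphere_eq_iff:
  assumes "r > 0" "s > 0"
  shows "sphere_horosphere z r = sphere_horosphere w s \<longleftrightarrow> z = w \<and> r = s"
proof
  assume eq: "sphere_horosphere z r = sphere_horosphere w s"
  have "(z, 2 * r) \<in> sphere_horosphere z r" "(w, 2 * s) \<in> sphere_horosphere w s"
    using assms by (simp_all add: mem_sphere_horosphere power2_eq_square)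
  then have "(z, 2 * r) \<in> sphere_horosphere w s" "(w, 2 * s) \<in> sphere_horosphere z r"
    by (simp_all add: eq)
  then have "(cmod (z - w))\<^sup>2 + 4 * r\<^sup>2 = 4 * r * s" "(cmod (z - w))\<^sup>2 + 4 * s\<^sup>2 = 4 * r * s"
    using assms by (simp_all add: mem_sphere_horosphere norm_minus_commute)
  then have "(cmod (z - w))\<^sup>2 + 2 * (r - s)\<^sup>2 = 0"
    by (simp add: power2_eq_square algebra_simps)
  then show "z = w \<and> r = s"
    by (simp add: add_nonneg_eq_0_iff)
qed auto

text \<open>A sphere has points at the two heights \<open>r\<close> and
  \<open>2 * r\<close>.\<close>

lemma sphere_neq_plane:
  assumes "r > 0"
  shows "sphere_horosphere z r \<noteq> plane_horosphere h"
proof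
  assume eq: "sphere_horosphere z r = plane_horosphere h"
  have "(z, 2 * r) \<in> sphere_horosphere z r" "(z + of_real r, r) \<in> sphere_horosphere z r"
    using assms by (simp_all add: mem_sphere_horosphere power2_eq_square)
  then show False
    using assms unfolding eq by simp
qed

section \<open>Tangency and disjointness in terms of base points, radii and heights\<close>

lemma tangent_commute: "tangent S T \<longleftrightarrow> tangent T S"
  by (simp add: tangent_def Int_commute)

lemma tangentD: "tangent S T \<Longrightarrow> p \<in> S \<Longrightarrow> p \<in> T \<Longrightarrow> q \<in> S \<Longrightarrow> q \<in> T \<Longrightarrow> p = q"
  unfolding tangent_def by (metis IntI singletonD)

text \<open>
  The two points witnessing that the spheres cross are reflections of each other in the vertical
  plane through the base points; their height is the one maximising the distance to that plane.
\<close>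

lemma sphere_horospheres_crossing:
  fixes z w :: complex
  assumes r: "r > 0" "s > 0" and ne: "z \<noteq> w" and lt: "(cmod (z - w))\<^sup>2 < 4 * r * s"
  obtains p q where "p \<noteq> q" "p \<in> sphere_horosphere z r" "p \<in> sphere_horosphere w s"
    "q \<in> sphere_horosphere z r" "q \<in> sphere_horosphere w s"
proof -
  define d where "d = (cmod (w - z))\<^sup>2"
  define D where "D = d + (s - r)\<^sup>2"
  define t where "t = (r + s) * d / (2 * D)"
  \<comment> \<open>In the form \<open>u = z + (w - z) * Complex a b\<close>, subtracting the two
    sphere equations fixes \<open>a\<close> in terms of \<open>t\<close>. The value \<open>e\<close>
    is what remains for \<open>b^2\<close>; it is quadratic in \<open>t\<close> and the chosen
    \<open>t\<close> maximises it.\<close>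
  define a where "a = 1/2 - (s - r) * t / d"
  define e where "e = ((r + s)\<^sup>2 / D - 1) / 4"
  have d: "d > 0" using ne by (simp add: d_def)
  have D: "D > 0" using d by (simp add: D_def add_pos_nonneg)
  have t: "t > 0" using r d D by (simp add: t_def)
  \<comment> \<open>This is the assumption \<open>lt\<close> with \<open>(s - r)^2\<close> added to
    both sides.\<close>
  have "D < (r + s)\<^sup>2"
    using lt by (simp add: D_def d_def norm_minus_commute power2_eq_square algebra_simps)
  then have e: "e > 0" using D by (simp add: e_def)
  have tD: "t * D = (r + s) * d / 2" using D by (simp add: t_def)
  have eD: "4 * e * D = (r + s)\<^sup>2 - D" using D by (simp add: e_def field_simps)
  have ad: "a * d = d/2 - (s - r) * t" using d by (simp add: a_def field_simps)
  have key1: "(a\<^sup>2 + e) * d + t\<^sup>2 = 2 * r * t"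
  proof -
    \<comment> \<open>Multiplying by \<open>4 * d * D\<close> clears all denominators, so that
      \<open>ad\<close>, \<open>eD\<close> and \<open>tD\<close> can be substituted as
      polynomials.\<close>
    have "((a\<^sup>2 + e) * d + t\<^sup>2 - 2 * r * t) * (4 * d * D) =
        4 * D * (a * d)\<^sup>2 + (4 * e * D) * d\<^sup>2 + 4 * d * D * t\<^sup>2 - 8 * r * t * d * D"
      by (simp add: power2_eq_square algebra_simps)
    also have "\<dots> = 4 * D * (d/2 - (s - r) * t)\<^sup>2 + ((r + s)\<^sup>2 - D) * d\<^sup>2 + 4 * d * D * t\<^sup>2
        - 8 * r * t * d * D"
      by (simp only: ad eD)
    also have "\<dots> = 4 * (t * D) * t * ((s - r)\<^sup>2 + d) - 4 * (t * D) * d * (s + r) + (r + s)\<^sup>2 * d\<^sup>2"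
      by (simp add: power2_eq_square algebra_simps)
    also have "\<dots> = 4 * (t * D) * (t * D) - 4 * (t * D) * d * (s + r) + (r + s)\<^sup>2 * d\<^sup>2"
      by (simp add: D_def add.commute)
    also have "\<dots> = 0"
      unfolding tD by (simp add: power2_eq_square field_simps)
    finally show ?thesis using d D by simp
  qed
  have key2: "((1 - a)\<^sup>2 + e) * d + t\<^sup>2 = 2 * s * t"
  proof -
    have "((1 - a)\<^sup>2 + e) * d + t\<^sup>2 = ((a\<^sup>2 + e) * d + t\<^sup>2) + d - 2 * (a * d)"
      by (simp add: power2_eq_square algebra_simps)
    also have "\<dots> = 2 * s * t"
      unfolding key1 ad by (simp add: algebra_simps)
    finally show ?thesis .
  qed
  define u where "u b = z + (w - z) * Complex a b" for b
  have c1: "(cmod (u b - z))\<^sup>2 = (a\<^sup>2 + b\<^sup>2) * d" for b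
    by (simp add: u_def d_def norm_mult power_mult_distrib cmod_power2)
  have "u b - w = (w - z) * Complex (a - 1) b" for b
    by (simp add: u_def complex_eq_iff algebra_simps)
  then have c2: "(cmod (u b - w))\<^sup>2 = ((1 - a)\<^sup>2 + b\<^sup>2) * d" for b
    by (simp add: d_def norm_mult power_mult_distrib cmod_power2 power2_commute)
  have mem: "(u b, t) \<in> sphere_horosphere z r" "(u b, t) \<in> sphere_horosphere w s"
    if "b\<^sup>2 = e" for b
    using t key1 key2 that r by (simp_all add: mem_sphere_horosphere c1 c2)
  have "u (sqrt e) \<noteq> u (- sqrt e)"
    using ne e by (simp add: u_def)
  then show ?thesis
    using e by (intro that[of "(u (sqrt e), t)" "(u (- sqrt e), t)"] mem) simp_all
qed

text \<open>Triangle inequality for the Euclidean centres: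
  \<open>|z - w|^2 + (r - s)^2 <= (r + s)^2\<close>.\<close>

lemma sphere_horospheres_meet_dist:
  assumes r: "r > 0" "s > 0"
    and p: "p \<in> sphere_horosphere z r" "p \<in> sphere_horosphere w s"
  shows "(cmod (z - w))\<^sup>2 \<le> 4 * r * s"
proof -
  have "dist p (z, r) = r" "dist p (w, s) = s"
    using p by (auto simp: sphere_horosphere_def dist_commute)
  then have "dist (z, r) (w, s) \<le> r + s"
    by (metis dist_triangle3)
  then have "(dist (z, r) (w, s))\<^sup>2 \<le> (r + s)\<^sup>2"
    by (simp add: power_mono)
  then show ?thesis
    by (simp add: dist_Pair_Pair dist_norm[of z w] dist_real_def power2_eq_square algebra_simps)
qed

text \<open>Meeting gives one inequality; the strict one would produce two common points. Distinct
  spheres with the same base point have no common point at positive height.\<close>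

lemma tangent_spheres_dist:
  assumes r: "r > 0" "s > 0"
    and ne: "sphere_horosphere z r \<noteq> sphere_horosphere w s"
    and tan: "tangent (sphere_horosphere z r) (sphere_horosphere w s)"
  shows "z \<noteq> w" "(cmod (z - w))\<^sup>2 = 4 * r * s"
proof -
  obtain u t where p: "(u, t) \<in> sphere_horosphere z r" "(u, t) \<in> sphere_horosphere w s"
    using tan unfolding tangent_def by (metis IntD1 IntD2 insertI1 prod.exhaust)
  show zw: "z \<noteq> w"
    using p ne r by (auto simp: mem_sphere_horosphere)
  have "\<not> (cmod (z - w))\<^sup>2 < 4 * r * s"
    using sphere_horospheres_crossing[OF r zw] tangentD[OF tan] by metis
  with sphere_horospheres_meet_dist[OF r p]
  show "(cmod (z - w))\<^sup>2 = 4 * r * s" by linarith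
qed

lemma packed_spheres_dist:
  assumes r: "r > 0" "s > 0" and zw: "z \<noteq> w"
    and "disjnt (sphere_horosphere z r) (sphere_horosphere w s) \<or>
      tangent (sphere_horosphere z r) (sphere_horosphere w s)"
  shows "(cmod (z - w))\<^sup>2 \<ge> 4 * r * s"
proof (rule ccontr)
  assume "\<not> 4 * r * s \<le> (cmod (z - w))\<^sup>2"
  then have lt: "(cmod (z - w))\<^sup>2 < 4 * r * s" by simp
  obtain p q where pq: "p \<noteq> q" "p \<in> sphere_horosphere z r" "p \<in> sphere_horosphere w s"
    "q \<in> sphere_horosphere z r" "q \<in> sphere_horosphere w s"
    by (rule sphere_horospheres_crossing[OF r zw lt])
  then have "tangent (sphere_horosphere z r) (sphere_horosphere w s)"
    using assms(4) unfolding disjnt_def by blast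
  from tangentD[OF this pq(2,3,4,5)] pq(1) show False by simp
qed

text \<open>A plane below the top of the sphere cuts it in a circle, which has two antipodal
  points.\<close>

lemma packed_sphere_plane:
  assumes r: "r > 0" "h > 0"
    and pk: "disjnt (sphere_horosphere z r) (plane_horosphere h) \<or>
      tangent (sphere_horosphere z r) (plane_horosphere h)"
  shows "2 * r \<le> h"
proof (rule ccontr)
  assume h: "\<not> 2 * r \<le> h"
  \<comment> \<open>The squared radius of the circle of intersection.\<close>
  define e where "e = 2 * r * h - h\<^sup>2"
  have e: "e > 0" using r h by (simp add: e_def power2_eq_square)
  have "(z + of_real b, h) \<in> sphere_horosphere z r" if "b\<^sup>2 = e" for b
    using that r by (simp add: mem_sphere_horosphere e_def)
  from this[of "sqrt e"] this[of "- sqrt e"]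
  have p: "(z + of_real (sqrt e), h) \<in> sphere_horosphere z r"
      "(z + of_real (- sqrt e), h) \<in> sphere_horosphere z r"
    using e by simp_all
  with pk have "tangent (sphere_horosphere z r) (plane_horosphere h)"
    by (metis disjnt_iff mem_plane_horosphere)
  from tangentD[OF this p(1) _ p(2)] e show False by simp
qed

lemma tangent_sphere_plane_iff:
  assumes r: "r > 0" "h > 0"
  shows "tangent (sphere_horosphere z r) (plane_horosphere h) \<longleftrightarrow> h = 2 * r"
proof
  assume t: "tangent (sphere_horosphere z r) (plane_horosphere h)"
  then obtain u where "(u, h) \<in> sphere_horosphere z r"
    unfolding tangent_def by (metis Int_iff insertI1 mem_plane_horosphere prod.exhaust)
  then have "h\<^sup>2 \<le> 2 * r * h"
    using r by (simp add: mem_sphere_horosphere) (smt (verit) zero_le_power2)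
  then have "h \<le> 2 * r" using r by (simp add: power2_eq_square)
  with packed_sphere_plane[OF r disjI2[OF t]] show "h = 2 * r" by simp
next
  assume h: "h = 2 * r"
  have "(u, t) \<in> sphere_horosphere z r \<inter> plane_horosphere h \<longleftrightarrow> (u, t) = (z, h)" for u t
    using r by (auto simp: mem_sphere_horosphere h power2_eq_square)
  then have "sphere_horosphere z r \<inter> plane_horosphere h = {(z, h)}"
    by (simp only: set_eq_iff split_paired_All) simp
  then show "tangent (sphere_horosphere z r) (plane_horosphere h)"
    unfolding tangent_def by blast
qed

lemma planes_not_tangent: "\<not> tangent (plane_horosphere h) (plane_horosphere k)"
proof
  assume t: "tangent (plane_horosphere h) (plane_horosphere k)"
  then obtain u a where "(u, a) \<in> plane_horosphere h \<inter> plane_horosphere k"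
    unfolding tangent_def by (metis insertI1 prod.exhaust)
  then have "h = k" by simp
  then show False
    using tangentD[OF t, of "(0, h)" "(1, h)"] by simp
qed

section \<open>The upper bound\<close>

lemma cos_ge_half: "cos x \<ge> 1/2" if "\<bar>x\<bar> \<le> pi/3"
  using cos_monotone_0_pi_le[of "\<bar>x\<bar>" "pi/3"] that by (simp add: cos_60)

lemma cos_gt_half: "cos x > 1/2" if "\<bar>x\<bar> < pi/3"
  using cos_monotone_0_pi[of "\<bar>x\<bar>" "pi/3"] that by (simp add: cos_60)

lemma Re_eq_cos_Arg2pi: "Re u = cmod u * cos (Arg2pi u)"
  and Im_eq_sin_Arg2pi: "Im u = cmod u * sin (Arg2pi u)"
proof -
  have "u = of_real (cmod u) * exp (\<i> * of_real (Arg2pi u))"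
    by (rule Arg2pi_eq)
  then have "u = of_real (cmod u) * cis (Arg2pi u)"
    by (simp add: cis_conv_exp)
  then have "Re u = Re (of_real (cmod u) * cis (Arg2pi u))"
    "Im u = Im (of_real (cmod u) * cis (Arg2pi u))"
    by simp_all
  then show "Re u = cmod u * cos (Arg2pi u)" "Im u = cmod u * sin (Arg2pi u)"
    by simp_all
qed

lemma inner_eq_cos_Arg2pi: "inner v w = cmod v * cmod w * cos (Arg2pi v - Arg2pi w)"
proof -
  have "inner v w = (cmod v * cos (Arg2pi v)) * (cmod w * cos (Arg2pi w))
      + (cmod v * sin (Arg2pi v)) * (cmod w * sin (Arg2pi w))"
    unfolding inner_complex_def using Re_eq_cos_Arg2pi Im_eq_sin_Arg2pi by metis
  then show ?thesis
    by (simp add: cos_diff algebra_simps)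
qed

text \<open>Angular separation becomes separation of real numbers in \<open>[0, 2 pi)\<close>.
  Closeness across the cut at angle 0 is not recorded, so the uses below bound the range of the
  arguments as well.\<close>

lemma Arg2pi_separated:
  assumes "v \<noteq> 0" "w \<noteq> 0" "2 * inner v w \<le> cmod v * cmod w"
  shows "\<bar>Arg2pi v - Arg2pi w\<bar> \<ge> pi/3"
proof (rule ccontr)
  assume "\<not> ?thesis"
  then have "cos (Arg2pi v - Arg2pi w) > 1/2"
    by (intro cos_gt_half) simp
  then have "inner v w > cmod v * cmod w * (1/2)"
    using assms unfolding inner_eq_cos_Arg2pi by (intro mult_strict_left_mono) simp_all
  with assms(3) show False by simp
qed

text \<open>Pigeonhole: the range splits into \<open>k\<close> half-open intervals of length
  \<open>d\<close>, each holding at most one value.\<close>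

lemma card_le_if_separated:
  fixes \<theta> :: "'a \<Rightarrow> real"
  assumes d: "d > 0"
    and sep: "\<And>x y. x \<in> N \<Longrightarrow> y \<in> N \<Longrightarrow> x \<noteq> y \<Longrightarrow> \<bar>\<theta> x - \<theta> y\<bar> \<ge> d"
    and range: "\<And>x. x \<in> N \<Longrightarrow> a \<le> \<theta> x \<and> \<theta> x < a + real k * d"
  shows "card N \<le> k"
proof -
  define f where "f x = \<lfloor>(\<theta> x - a) / d\<rfloor>" for x
  have "x = y" if xy: "x \<in> N" "y \<in> N" "f x = f y" for x y
  proof (rule ccontr)
    assume "x \<noteq> y"
    have "\<bar>(\<theta> x - a) / d - (\<theta> y - a) / d\<bar> < 1"
      using xy(3) unfolding f_def by linarith
    moreover have "(\<theta> x - a) / d - (\<theta> y - a) / d = (\<theta> x - \<theta> y) / d"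
      by (simp add: diff_divide_distrib)
    ultimately have "\<bar>\<theta> x - \<theta> y\<bar> < d"
      using d by simp
    with sep[OF xy(1,2) \<open>x \<noteq> y\<close>] show False by simp
  qed
  then have "inj_on f N" by (rule inj_onI)
  moreover have "f ` N \<subseteq> {0..<int k}"
  proof safe
    fix x assume "x \<in> N"
    with range have "0 \<le> (\<theta> x - a) / d" "(\<theta> x - a) / d < real k"
      using d by (simp_all add: pos_divide_less_eq algebra_simps)
    then show "f x \<in> {0..<int k}"
      by (simp add: f_def floor_less_iff)
  qed
  ultimately show ?thesis
    using card_inj_on_le[of f N "{0..<int k}"] by simp
qed

lemma card_half_plane_le_4:
  assumes nz: "0 \<notin> V" and half: "\<And>v. v \<in> V \<Longrightarrow> Im v \<ge> 0"
    and sep: "\<And>v w. v \<in> V \<Longrightarrow> w \<in> V \<Longrightarrow> v \<noteq> w \<Longrightarrow> 2 * inner v w \<le> cmod v * cmod w"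
  shows "card V \<le> 4"
proof (rule card_le_if_separated[where \<theta> = Arg2pi and a = 0 and d = "pi/3"])
  fix v assume v: "v \<in> V"
  then have "Arg2pi v \<le> pi"
    using half by (simp add: Arg2pi_le_pi)
  \<comment> \<open>The argument \<open>pi\<close> itself may occur, so three half-open intervals of
    length \<open>pi/3\<close> do not suffice.\<close>
  moreover have "pi < 0 + real 4 * (pi / 3)" by simp
  ultimately show "0 \<le> Arg2pi v \<and> Arg2pi v < 0 + real 4 * (pi / 3)"
    using Arg2pi_ge_0[of v] by linarith
next
  fix v w assume vw: "v \<in> V" "w \<in> V" "v \<noteq> w"
  then have "v \<noteq> 0" "w \<noteq> 0" using nz by auto
  then show "pi / 3 \<le> \<bar>Arg2pi v - Arg2pi w\<bar>"
    using sep[OF vw] by (rule Arg2pi_separated)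
qed simp

text \<open>Measured from \<open>u\<close>, all other arguments lie strictly between
  \<open>pi/3\<close> and \<open>5 pi/3\<close>, a range covered by four half-open intervals;
  \<open>u\<close> is the fifth vector. Strictness excludes the regular hexagon.\<close>

lemma card_le_5_if_strict:
  assumes nz: "0 \<notin> V" and u: "u \<in> V"
    and sep: "\<And>v w. v \<in> V \<Longrightarrow> w \<in> V \<Longrightarrow> v \<noteq> w \<Longrightarrow> 2 * inner v w \<le> cmod v * cmod w"
    and strict: "\<And>v. v \<in> V \<Longrightarrow> v \<noteq> u \<Longrightarrow> 2 * inner v u < cmod v * cmod u"
  shows "card V \<le> 5"
proof -
  have u0: "u \<noteq> 0" using u nz by auto
  \<comment> \<open>Multiplication by \<open>cnj u\<close> turns \<open>u\<close> onto the positive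
    real axis and scales all inner products alike, so the separation persists.\<close>
  have rot: "inner (v * cnj u) (w * cnj u) = (cmod u)\<^sup>2 * inner v w" for v w
    unfolding cmod_power2 by (simp add: inner_complex_def power2_eq_square algebra_simps)
  have "card (V - {u}) \<le> 4"
  proof (rule card_le_if_separated[where \<theta> = "\<lambda>v. Arg2pi (v * cnj u)" and a = "pi/3" and d = "pi/3"])
    fix v assume "v \<in> V - {u}"
    then have v: "v \<in> V" "v \<noteq> u" "v \<noteq> 0" using nz by auto
    define t where "t = Arg2pi (v * cnj u)"
    have "cmod v * cmod u * cos t = Re (v * cnj u)"
      unfolding t_def Re_eq_cos_Arg2pi[of "v * cnj u"] by (simp add: norm_mult)
    also have "\<dots> = inner v u"
      by (simp add: inner_complex_def)
    also have "\<dots> < cmod v * cmod u * (1/2)"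
      using strict[OF v(1,2)] by simp
    finally have c: "cos t < 1/2"
      using v u0 by (subst (asm) mult_less_cancel_left_pos) simp_all
    have "\<not> t \<le> pi/3"
      using cos_ge_half[of t] Arg2pi_ge_0[of "v * cnj u"] c by (auto simp: t_def)
    moreover have "\<not> t \<ge> 5 * pi/3"
      using cos_ge_half[of "2 * pi - t"] Arg2pi_lt_2pi[of "v * cnj u"] c
      by (auto simp: t_def cos_diff)
    ultimately show "pi/3 \<le> Arg2pi (v * cnj u) \<and> Arg2pi (v * cnj u) < pi/3 + real 4 * (pi/3)"
      unfolding t_def by simp
  next
    fix v w assume vw: "v \<in> V - {u}" "w \<in> V - {u}" "v \<noteq> w"
    have "2 * inner (v * cnj u) (w * cnj u) = (cmod u)\<^sup>2 * (2 * inner v w)"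
      by (simp add: rot)
    also have "\<dots> \<le> (cmod u)\<^sup>2 * (cmod v * cmod w)"
      using sep vw by (intro mult_left_mono) auto
    also have "\<dots> = cmod (v * cnj u) * cmod (w * cnj u)"
      by (simp add: norm_mult power2_eq_square)
    finally show "pi/3 \<le> \<bar>Arg2pi (v * cnj u) - Arg2pi (w * cnj u)\<bar>"
      using vw nz u0 by (intro Arg2pi_separated) auto
  qed simp
  then show ?thesis
    by (simp add: card_Diff_singleton u)
qed

text \<open>By the law of cosines \<open>2 * inner v w <= 4 r (s + t) - 4 s t = 4 r^2 - 4 (s - r) (t
  - r)\<close>, which is at most \<open>4 r^2\<close>, while
  \<open>|v| |w| = 4 r sqrt (s t) >= 4 r^2\<close>, strictly if \<open>s > r\<close>.\<close>

lemma neighbour_directions: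
  fixes v w :: complex
  assumes r: "r > 0" "s \<ge> r" "t \<ge> r"
    and v: "(cmod v)\<^sup>2 = 4 * r * s" and w: "(cmod w)\<^sup>2 = 4 * r * t"
    and vw: "(cmod (v - w))\<^sup>2 \<ge> 4 * s * t"
  shows "2 * inner v w \<le> cmod v * cmod w"
    and "s > r \<Longrightarrow> 2 * inner v w < cmod v * cmod w"
proof -
  have "(cmod (v - w))\<^sup>2 = (cmod v)\<^sup>2 + (cmod w)\<^sup>2 - 2 * inner v w"
    by (simp add: power2_norm_eq_inner inner_diff inner_commute)
  with vw v w have "2 * inner v w \<le> 4 * r\<^sup>2 - 4 * ((s - r) * (t - r))"
    by (simp add: power2_eq_square algebra_simps)
  then have le: "2 * inner v w \<le> 4 * r\<^sup>2"
    using r by (smt (verit) mult_nonneg_nonneg)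
  have sq: "(cmod v * cmod w)\<^sup>2 = 16 * r\<^sup>2 * (s * t)"
    unfolding power_mult_distrib v w by (simp add: power2_eq_square)
  have sq4: "(4 * r\<^sup>2)\<^sup>2 = 16 * r\<^sup>2 * (r * r)"
    by (simp add: power2_eq_square)
  have "r * r \<le> s * t" using r by (intro mult_mono) auto
  then have "(4 * r\<^sup>2)\<^sup>2 \<le> (cmod v * cmod w)\<^sup>2"
    unfolding sq sq4 by (intro mult_left_mono) auto
  then have "4 * r\<^sup>2 \<le> cmod v * cmod w"
    by (rule power2_le_imp_le) simp
  with le show "2 * inner v w \<le> cmod v * cmod w" by simp
  show "2 * inner v w < cmod v * cmod w" if "s > r"
  proof -
    have "r * r < s * t" using r that by (intro mult_less_le_imp_less) auto
    then have "(4 * r\<^sup>2)\<^sup>2 < (cmod v * cmod w)\<^sup>2"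
      unfolding sq sq4 using r by (intro mult_strict_left_mono) auto
    then have "4 * r\<^sup>2 < cmod v * cmod w"
      by (rule power2_less_imp_less) simp
    with le show ?thesis by simp
  qed
qed

section \<open>Finding and removing a horosphere with at most five neighbours\<close>

text \<open>A class closed under removing a horosphere, as the induction requires; connectedness
  could be lost.\<close>

definition packed :: "(complex \<times> real) set set \<Rightarrow> bool" where
  "packed P \<longleftrightarrow> finite P \<and> (\<forall>S\<in>P. horosphere S) \<and>
     (\<forall>S\<in>P. \<forall>T\<in>P. S \<noteq> T \<longrightarrow> disjnt S T \<or> tangent S T)"

definition neighbours :: "(complex \<times> real) set set \<Rightarrow> (complex \<times> real) set \<Rightarrow> (complex \<times> real) set set" where
  "neighbours P S = {T \<in> P. T \<noteq> S \<and> tangent S T}"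

lemma smallest_bottommost_degree:
  assumes P: "packed P" and r: "r > 0" and S: "sphere_horosphere z r \<in> P"
    and min: "\<And>w s. s > 0 \<Longrightarrow> sphere_horosphere w s \<in> P \<Longrightarrow> r \<le> s"
    and bot: "\<And>w. sphere_horosphere w r \<in> P \<Longrightarrow> Im z \<le> Im w"
  shows "card (neighbours P (sphere_horosphere z r)) \<le> 5"
proof -
  define S where "S = sphere_horosphere z r"
  \<comment> \<open>\<open>M\<close> lists the spherical neighbours by base point and radius,
    \<open>V\<close> their directions seen from \<open>z\<close>, and \<open>H\<close> holds the
    only plane that can touch \<open>S\<close>.\<close>
  define M where "M = {(w, s). s > 0 \<and> sphere_horosphere w s \<in> neighbours P S}"
  define V where "V = (\<lambda>(w, s). w - z) ` M"
  define H where "H = (if plane_horosphere (2 * r) \<in> P then {plane_horosphere (2 * r)} else {})"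
  have dist: "s \<ge> r" "w \<noteq> z" "(cmod (w - z))\<^sup>2 = 4 * r * s" "s > 0" if "(w, s) \<in> M" for w s
    using that tangent_spheres_dist[OF r, of s z w] min[of s w]
    by (auto simp: M_def neighbours_def S_def norm_minus_commute)
  have dist2: "(cmod ((w - z) - (w' - z)))\<^sup>2 \<ge> 4 * s * s'"
    if "(w, s) \<in> M" "(w', s') \<in> M" "w \<noteq> w'" for w s w' s'
  proof -
    have "s > 0" "s' > 0" "sphere_horosphere w s \<in> P" "sphere_horosphere w' s' \<in> P"
      using that by (auto simp: M_def neighbours_def)
    then show ?thesis
      using packed_spheres_dist[of s s' w w'] that(3) P
      by (simp add: packed_def sphere_horosphere_eq_iff)
  qed
  have sep: "2 * inner v w \<le> cmod v * cmod w" if "v \<in> V" "w \<in> V" "v \<noteq> w" for v w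
    using that neighbour_directions(1)[OF r dist(1) dist(1) dist(3) dist(3) dist2]
    by (auto simp: V_def)
  \<comment> \<open>The distance to \<open>z\<close> determines the radius of a neighbour, so no
    direction vector is counted twice.\<close>
  have inj: "inj_on (\<lambda>(w, s). w - z) M"
  proof (rule inj_onI, clarsimp)
    fix w s t assume "(w, s) \<in> M" "(w, t) \<in> M"
    then have "4 * r * s = 4 * r * t"
      using dist(3) by metis
    then show "s = t" using r by simp
  qed
  have nz: "0 \<notin> V"
    using dist(2) by (auto simp: V_def)
  have cardV: "card V = card M"
    unfolding V_def by (rule card_image[OF inj])
  \<comment> \<open>Neighbours of radius \<open>r\<close> compete in \<open>bot\<close>, which puts
    all directions into the closed upper half-plane.\<close>
  have equal: "card M \<le> 4" if "\<And>w s. (w, s) \<in> M \<Longrightarrow> s = r"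
  proof -
    have "Im v \<ge> 0" if "v \<in> V" for v
      using that \<open>\<And>w s. (w, s) \<in> M \<Longrightarrow> s = r\<close> bot
      by (fastforce simp: V_def M_def neighbours_def)
    then show ?thesis
      using card_half_plane_le_4[OF nz _ sep] cardV by simp
  qed
  have M5: "card M \<le> 5"
  proof (cases "\<forall>w s. (w, s) \<in> M \<longrightarrow> s = r")
    case True
    then show ?thesis using equal by fastforce
  next
    case False
    then obtain w s where ws: "(w, s) \<in> M" "s \<noteq> r" by blast
    have "card V \<le> 5"
    proof (rule card_le_5_if_strict[OF nz _ sep, where u = "w - z"])
      show "w - z \<in> V" using ws by (force simp: V_def)
      fix v assume "v \<in> V" "v \<noteq> w - z"
      then obtain w' s' where v: "v = w' - z" "(w', s') \<in> M" "w \<noteq> w'"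
        by (auto simp: V_def)
      show "2 * inner v (w - z) < cmod v * cmod (w - z)"
        using neighbour_directions(2)[OF r dist(1) dist(1) dist(3) dist(3) dist2, OF ws(1) v(2)
          ws(1) v(2) ws(1) v(2) v(3)] ws(2) dist(1)[OF ws(1)]
        by (simp add: v(1) inner_commute mult.commute)
    qed
    then show ?thesis by (simp add: cardV)
  qed
  have sub: "neighbours P S \<subseteq> (\<lambda>(w, s). sphere_horosphere w s) ` M \<union> H"
  proof
    fix T assume T: "T \<in> neighbours P S"
    then have "horosphere T" using P by (auto simp: packed_def neighbours_def)
    then show "T \<in> (\<lambda>(w, s). sphere_horosphere w s) ` M \<union> H"
    proof (cases rule: horosphere_cases)
      case (sphere w s)
      with T show ?thesis by (force simp: M_def)
    next
      case (plane h)
      with T show ?thesis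
        using tangent_sphere_plane_iff[OF r plane(1), of z]
        by (auto simp: neighbours_def S_def H_def)
    qed
  qed
  have "finite (neighbours P S)"
    using P by (simp add: packed_def neighbours_def)
  moreover have "inj_on (\<lambda>(w, s). sphere_horosphere w s) M"
    using dist(4) by (auto intro!: inj_onI simp: sphere_horosphere_eq_iff)
  moreover have "(\<lambda>(w, s). sphere_horosphere w s) ` M \<subseteq> neighbours P S"
    by (auto simp: M_def)
  ultimately have "finite M"
    by (metis finite_imageD finite_subset)
  then have "card (neighbours P S) \<le> card ((\<lambda>(w, s). sphere_horosphere w s) ` M \<union> H)"
    using sub by (intro card_mono) (simp_all add: H_def)
  also have "\<dots> \<le> card M + card H"
    by (meson card_Un_le add_mono card_image_le[OF \<open>finite M\<close>] order_refl order_trans)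
  also have "\<dots> \<le> 5"
  proof (cases "plane_horosphere (2 * r) \<in> P")
    case True
    \<comment> \<open>Spheres must fit under the plane that rests on \<open>S\<close>, so none is
      larger than \<open>S\<close>; the count is then at most 4 + 1.\<close>
    have "s = r" if "(w, s) \<in> M" for w s
    proof -
      have "s > 0" "sphere_horosphere w s \<in> P"
        using that by (auto simp: M_def neighbours_def)
      moreover have "sphere_horosphere w s \<noteq> plane_horosphere (2 * r)"
        using dist(4)[OF that] by (rule sphere_neq_plane)
      ultimately have "2 * s \<le> 2 * r"
        using packed_sphere_plane[of s "2 * r" w] r True P by (auto simp: packed_def)
      with dist(1)[OF that] show ?thesis by simp
    qed
    then show ?thesis using equal by (simp add: H_def)
  next
    case False
    then show ?thesis using M5 by (simp add: H_def)
  qed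
  finally show ?thesis by (simp add: S_def)
qed

lemma finite_tangencies:
  "finite P \<Longrightarrow> finite {{S, T} |S T. S \<in> P \<and> T \<in> P \<and> S \<noteq> T \<and> tangent S T}"
  by (rule finite_subset[of _ "Pow P"]) auto

text \<open>Each tangent pair either avoids \<open>S\<close> or has the form \<open>{S, T}\<close>
  with \<open>T\<close> a neighbour.\<close>

lemma num_tangencies_remove:
  assumes "finite P"
  shows "num_tangencies P \<le> num_tangencies (P - {S}) + card (neighbours P S)"
proof -
  let ?E = "\<lambda>P. {{S, T} |S T. S \<in> P \<and> T \<in> P \<and> S \<noteq> T \<and> tangent S T}"
  have fin: "finite (?E (P - {S}))" "finite (neighbours P S)"
    using assms finite_tangencies[of "P - {S}"] by (simp_all add: neighbours_def)
  have "?E P \<subseteq> ?E (P - {S}) \<union> (\<lambda>T. {S, T}) ` neighbours P S"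
  proof
    fix e assume "e \<in> ?E P"
    then obtain T U where e: "e = {T, U}" "T \<in> P" "U \<in> P" "T \<noteq> U" "tangent T U"
      by blast
    consider "T = S" | "U = S" | "T \<noteq> S" "U \<noteq> S" by blast
    then show "e \<in> ?E (P - {S}) \<union> (\<lambda>T. {S, T}) ` neighbours P S"
    proof cases
      case 1
      with e show ?thesis by (auto simp: neighbours_def)
    next
      case 2
      with e have "T \<in> neighbours P S" "e = {S, T}"
        by (auto simp: neighbours_def tangent_commute)
      then show ?thesis by blast
    next
      case 3
      with e show ?thesis by blast
    qed
  qed
  then have "card (?E P) \<le> card (?E (P - {S}) \<union> (\<lambda>T. {S, T}) ` neighbours P S)"
    using fin by (intro card_mono) simp_all
  also have "\<dots> \<le> card (?E (P - {S})) + card (neighbours P S)"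
    by (meson card_Un_le add_left_mono card_image_le[OF fin(2)] order_trans)
  finally show ?thesis unfolding num_tangencies_def .
qed

text \<open>Finiteness provides a sphere that is lexicographically least in radius and imaginary
  part of the base point.\<close>

lemma packed_obtains_low_degree:
  assumes P: "packed P" and "r0 > 0" "sphere_horosphere z0 r0 \<in> P"
  obtains S where "S \<in> P" "card (neighbours P S) \<le> 5"
proof -
  define B where "B = {(w, s). s > 0 \<and> sphere_horosphere w s \<in> P}"
  have "inj_on (\<lambda>(w, s). sphere_horosphere w s) B"
    by (auto intro!: inj_onI simp: sphere_horosphere_eq_iff B_def)
  moreover have "(\<lambda>(w, s). sphere_horosphere w s) ` B \<subseteq> P"
    by (auto simp: B_def)
  ultimately have finB: "finite B"
    using P unfolding packed_def by (metis finite_imageD finite_subset)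
  have "B \<noteq> {}" using assms by (auto simp: B_def)
  define r where "r = Min (snd ` B)"
  have "r \<in> snd ` B"
    unfolding r_def using finB \<open>B \<noteq> {}\<close> by (intro Min_in) auto
  then obtain w where w: "r > 0" "sphere_horosphere w r \<in> P"
    by (auto simp: B_def)
  have min: "r \<le> s" if "s > 0" "sphere_horosphere u s \<in> P" for u s
    unfolding r_def using finB that by (intro Min_le) (force simp: B_def)+
  define Z where "Z = {z. sphere_horosphere z r \<in> P}"
  have finZ: "finite Z"
    by (rule finite_subset[of _ "fst ` B"]) (use finB w in \<open>force simp: Z_def B_def\<close>)+
  have "Min (Im ` Z) \<in> Im ` Z"
    using finZ w by (intro Min_in) (auto simp: Z_def)
  then obtain z where z: "z \<in> Z" "Im z = Min (Im ` Z)" by auto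
  have "Im z \<le> Im u" if "sphere_horosphere u r \<in> P" for u
    unfolding z(2) using finZ that by (intro Min_le) (auto simp: Z_def)
  with z(1) have "card (neighbours P (sphere_horosphere z r)) \<le> 5"
    by (intro smallest_bottommost_degree[OF P w(1) _ min]) (auto simp: Z_def)
  with z(1) show ?thesis
    by (intro that[of "sphere_horosphere z r"]) (simp_all add: Z_def)
qed

lemma num_tangencies_le:
  assumes "packed P"
  shows "num_tangencies P \<le> 5 * card P"
  using assms
proof (induction "card P" arbitrary: P rule: less_induct)
  case less
  have fin: "finite P" using less.prems by (simp add: packed_def)
  show ?case
  proof (cases "\<exists>z r. r > 0 \<and> sphere_horosphere z r \<in> P")
    case True
    then obtain S where S: "S \<in> P" "card (neighbours P S) \<le> 5"
      using packed_obtains_low_degree[OF less.prems] by metis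
    have "packed (P - {S})" using less.prems by (simp add: packed_def)
    moreover have card: "card P = Suc (card (P - {S}))"
      using card.remove[OF fin S(1)] .
    ultimately have "num_tangencies (P - {S}) \<le> 5 * card (P - {S})"
      using less.hyps by simp
    with num_tangencies_remove[OF fin, of S] S(2) card show ?thesis by linarith
  next
    case False
    have plane: "\<exists>h. S = plane_horosphere h" if "S \<in> P" for S
    proof -
      have "horosphere S" using that less.prems by (auto simp: packed_def)
      then show ?thesis
        using False that by (cases rule: horosphere_cases) auto
    qed
    have "\<not> tangent S T" if "S \<in> P" "T \<in> P" for S T
      using plane[OF that(1)] plane[OF that(2)] planes_not_tangent by auto
    then have "{{S, T} |S T. S \<in> P \<and> T \<in> P \<and> S \<noteq> T \<and> tangent S T} = {}"
      by blast
    then have "num_tangencies P = 0"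
      by (simp only: num_tangencies_def card.empty)
    then show ?thesis by simp
  qed
qed

section \<open>The lower bound\<close>

text \<open>Stereographic projection from the base point: the ray from \<open>(z, 0)\<close> in
  direction \<open>(u, 1)\<close> meets the sphere at height \<open>c u\<close>, so the horosphere
  is a continuous image of the plane.\<close>

lemma connected_sphere_horosphere:
  assumes "r > 0"
  shows "connected (sphere_horosphere z r)"
proof -
  define c where "c u = 2 * r / (1 + (cmod u)\<^sup>2)" for u
  define g where "g u = (z + of_real (c u) * u, c u)" for u
  have pos: "1 + (cmod u)\<^sup>2 > 0" for u :: complex
    by (simp add: add_pos_nonneg)
  then have ne: "1 + (cmod u)\<^sup>2 \<noteq> 0" for u :: complex
    by (metis less_irrefl)
  have "sphere_horosphere z r = range g"
  proof (intro subset_antisym subsetI)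
    fix p assume p: "p \<in> sphere_horosphere z r"
    obtain w t where wt: "p = (w, t)" by force
    with p have t: "t > 0" and eq: "(cmod (w - z))\<^sup>2 + t\<^sup>2 = 2 * r * t"
      using assms by (auto simp: mem_sphere_horosphere)
    define u where "u = (w - z) / of_real t"
    have "(1 + (cmod u)\<^sup>2) * t\<^sup>2 = 2 * r * t"
      using t eq by (simp add: u_def norm_divide field_simps)
    then have "(1 + (cmod u)\<^sup>2) * t = 2 * r"
      using t by (simp add: power2_eq_square)
    then have "c u = t"
      using ne[of u] by (simp add: c_def field_simps)
    then have "g u = p"
      using t by (simp add: g_def wt u_def)
    then show "p \<in> range g" by blast
  next
    fix p assume "p \<in> range g"
    then obtain u where u: "p = g u" by blast
    have c: "c u > 0" using assms pos by (simp add: c_def)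
    have "(cmod (of_real (c u) * u))\<^sup>2 + (c u)\<^sup>2 = c u * (c u * (1 + (cmod u)\<^sup>2))"
      by (simp add: norm_mult power_mult_distrib power2_eq_square algebra_simps)
    also have "c u * (1 + (cmod u)\<^sup>2) = 2 * r"
      using ne[of u] by (simp add: c_def)
    finally show "p \<in> sphere_horosphere z r"
      using c assms by (simp add: u g_def mem_sphere_horosphere)
  qed
  moreover have "continuous_on UNIV g"
    unfolding g_def c_def by (intro continuous_intros) (use ne in auto)
  ultimately show ?thesis
    using connected_continuous_image[OF _ connected_UNIV] by metis
qed

text \<open>The parallelogram law about the midpoint \<open>m\<close> gives
  \<open>|u - m|^2 + (t - 1)^2 = 1 - |z - w|^2 / 4\<close>, which is at most 0.\<close>

lemma unit_spheres_meet:
  assumes far: "cmod (z - w) \<ge> 2"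
    and mem: "(u, t) \<in> sphere_horosphere z 1" "(u, t) \<in> sphere_horosphere w 1"
  shows "u = (z + w) / 2" "t = 1"
proof -
  define m where "m = (z + w) / 2"
  have "(cmod (u - z))\<^sup>2 + (cmod (u - w))\<^sup>2 = 2 * (cmod (u - m))\<^sup>2 + (cmod (z - w))\<^sup>2 / 2"
    unfolding cmod_power2 by (simp add: m_def power2_eq_square field_simps)
  moreover have "(cmod (u - z))\<^sup>2 + t\<^sup>2 = 2 * t" "(cmod (u - w))\<^sup>2 + t\<^sup>2 = 2 * t"
    using mem by (simp_all add: mem_sphere_horosphere)
  moreover have "(t - 1)\<^sup>2 = t\<^sup>2 - 2 * t + 1"
    by (simp add: power2_eq_square algebra_simps)
  moreover have "(cmod (z - w))\<^sup>2 \<ge> 2\<^sup>2"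
    using far by (intro power_mono) auto
  ultimately have "(cmod (u - m))\<^sup>2 + (t - 1)\<^sup>2 \<le> 0"
    by simp
  then have "(cmod (u - m))\<^sup>2 = 0 \<and> (t - 1)\<^sup>2 = 0"
    by (smt (verit) zero_le_power2)
  then show "u = (z + w) / 2" "t = 1" by (simp_all add: m_def)
qed

lemma unit_spheres_packed:
  assumes "cmod (z - w) \<ge> 2"
  shows "disjnt (sphere_horosphere z 1) (sphere_horosphere w 1) \<or>
    tangent (sphere_horosphere z 1) (sphere_horosphere w 1)"
proof -
  have "sphere_horosphere z 1 \<inter> sphere_horosphere w 1 \<subseteq> {((z + w) / 2, 1)}"
    using unit_spheres_meet[OF assms] by auto
  then show ?thesis
    unfolding disjnt_def tangent_def by blast
qed

lemma unit_spheres_tangent: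
  assumes "cmod (z - w) = 2"
  shows "tangent (sphere_horosphere z 1) (sphere_horosphere w 1)"
proof -
  have "(z + w) / 2 - z = (w - z) / 2" "(z + w) / 2 - w = (z - w) / 2"
    by (simp_all add: field_simps)
  then have "cmod ((z + w) / 2 - z) = 1" "cmod ((z + w) / 2 - w) = 1"
    using assms by (simp_all only: norm_divide norm_minus_commute[of w z]) simp_all
  then have "((z + w) / 2, 1) \<in> sphere_horosphere z 1 \<inter> sphere_horosphere w 1"
    by (simp add: mem_sphere_horosphere)
  moreover have "sphere_horosphere z 1 \<inter> sphere_horosphere w 1 \<subseteq> {((z + w) / 2, 1)}"
    using unit_spheres_meet[of z w] assms by auto
  ultimately show ?thesis
    unfolding tangent_def by blast
qed

text \<open>The plane rests on the tops of all the unit spheres, which adds one tangency per sphere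
  and makes the union connected for every \<open>A\<close>.\<close>

definition table_packing :: "complex set \<Rightarrow> (complex \<times> real) set set" where
  "table_packing A = insert (plane_horosphere 2) ((\<lambda>z. sphere_horosphere z 1) ` A)"

lemma card_table_packing:
  assumes "finite A"
  shows "card (table_packing A) = Suc (card A)"
proof -
  have "inj_on (\<lambda>z. sphere_horosphere z 1) A"
    by (auto intro!: inj_onI simp: sphere_horosphere_eq_iff)
  moreover have "plane_horosphere 2 \<notin> (\<lambda>z. sphere_horosphere z 1) ` A"
    using sphere_neq_plane[of 1 _ 2] by fastforce
  ultimately show ?thesis
    using assms by (simp add: table_packing_def card_image)
qed

lemma horosphere_packing_table:
  assumes "finite A" and sep: "\<And>z w. z \<in> A \<Longrightarrow> w \<in> A \<Longrightarrow> z \<noteq> w \<Longrightarrow> cmod (z - w) \<ge> 2"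
  shows "horosphere_packing (table_packing A)"
proof -
  let ?P = "plane_horosphere 2" and ?S = "\<lambda>z. sphere_horosphere z 1"
  have tan: "tangent (?S z) ?P" for z
    by (simp add: tangent_sphere_plane_iff)
  have P: "?P = range (\<lambda>z. (z, 2))"
    by (auto simp: plane_horosphere_def)
  have conP: "connected ?P"
    unfolding P by (intro connected_continuous_image continuous_intros connected_UNIV)
  have conU: "connected (?P \<union> ?S z)" for z
    using tan[of z] conP by (intro connected_Un connected_sphere_horosphere) (auto simp: tangent_def)
  \<comment> \<open>Joining each sphere with the plane yields connected sets that all contain
    \<open>(0, 2)\<close>.\<close>
  let ?U = "insert ?P ((\<lambda>z. ?P \<union> ?S z) ` A)"
  have "connected (\<Union>?U)"
  proof (rule connected_Union)
    have "(0, 2) \<in> \<Inter>?U" by simp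
    then show "\<Inter>?U \<noteq> {}" by blast
  qed (use conP conU in auto)
  moreover have "\<Union>?U = \<Union>(table_packing A)"
    by (auto simp: table_packing_def)
  ultimately have "connected (\<Union>(table_packing A))" by simp
  moreover have "disjnt S T \<or> tangent S T"
    if "S \<in> table_packing A" "T \<in> table_packing A" "S \<noteq> T" for S T
    using that tan tangent_commute[of ?P] sep unit_spheres_packed
    by (fastforce simp: table_packing_def)
  ultimately show ?thesis
    using assms(1) by (auto simp: horosphere_packing_def table_packing_def
        intro: horosphere_sphere horosphere_plane)
qed

section \<open>The hexagonal lattice and its tangencies\<close>

text \<open>Lattice coordinates for the generators 2 and \<open>1 + sqrt 3 * \<i>\<close>, both of
  length 2.\<close>

definition hex_point :: "nat \<times> nat \<Rightarrow> complex" where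
  "hex_point = (\<lambda>(i, j). Complex (2 * real i + real j) (sqrt 3 * real j))"

lemma hex_point_dist:
  fixes i j k l :: nat
  defines "a \<equiv> int i - int k" and "b \<equiv> int j - int l"
  shows "(cmod (hex_point (i, j) - hex_point (k, l)))\<^sup>2 = 4 * of_int (a\<^sup>2 + a * b + b\<^sup>2)"
proof -
  have "Re (hex_point (i, j) - hex_point (k, l)) = 2 * of_int a + of_int b"
    "Im (hex_point (i, j) - hex_point (k, l)) = sqrt 3 * of_int b"
    by (simp_all add: hex_point_def a_def b_def algebra_simps)
  then show ?thesis
    unfolding cmod_power2 by (simp add: power_mult_distrib) (simp add: power2_eq_square algebra_simps)
qed

lemma hex_points_adjacent:
  "cmod (hex_point (i, j) - hex_point (Suc i, j)) = 2"
  "cmod (hex_point (i, j) - hex_point (i, Suc j)) = 2"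
  "cmod (hex_point (Suc i, j) - hex_point (i, Suc j)) = 2"
proof -
  have *: "cmod (hex_point (i, j) - hex_point (k, l)) = 2"
    if "(int i - int k)\<^sup>2 + (int i - int k) * (int j - int l) + (int j - int l)\<^sup>2 = 1" for i j k l
    by (rule power2_eq_imp_eq) (simp_all only: hex_point_dist that, simp_all)
  show "cmod (hex_point (i, j) - hex_point (Suc i, j)) = 2"
    "cmod (hex_point (i, j) - hex_point (i, Suc j)) = 2"
    "cmod (hex_point (Suc i, j) - hex_point (i, Suc j)) = 2"
    by (rule *, simp)+
qed

lemma hex_points_separated:
  assumes "p \<noteq> q"
  shows "cmod (hex_point p - hex_point q) \<ge> 2"
proof -
  obtain i j k l where pq: "p = (i, j)" "q = (k, l)" by force
  define a b where "a = int i - int k" and "b = int j - int l"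
  have "a \<noteq> 0 \<or> b \<noteq> 0" using assms by (auto simp: pq a_def b_def)
  \<comment> \<open>Completing the square: this is \<open>4 * c\<close>, so the integer
    \<open>c\<close> is positive and hence at least 1.\<close>
  then have "(2 * a + b)\<^sup>2 + 3 * b\<^sup>2 > 0"
    by (cases "b = 0") (auto simp: add_nonneg_pos)
  moreover define c where "c = a\<^sup>2 + a * b + b\<^sup>2"
  ultimately have "c \<ge> 1"
    by (simp add: power2_eq_square algebra_simps)
  moreover have "(cmod (hex_point p - hex_point q))\<^sup>2 = 4 * of_int c"
    unfolding pq hex_point_dist c_def a_def b_def ..
  ultimately have "(cmod (hex_point p - hex_point q))\<^sup>2 \<ge> 2\<^sup>2"
    by simp
  then show ?thesis
    by (rule power2_le_imp_le) simp
qed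

lemma inj_hex_point: "inj hex_point"
proof (rule injI, rule ccontr)
  fix p q assume "hex_point p = hex_point q" "p \<noteq> q"
  then show False using hex_points_separated[of p q] by simp
qed

definition hex_packing :: "nat \<Rightarrow> (complex \<times> real) set set" where
  "hex_packing k = table_packing (hex_point ` ({..k} \<times> {..k}))"

lemma horosphere_packing_hex: "horosphere_packing (hex_packing k)"
  unfolding hex_packing_def
  by (intro horosphere_packing_table) (auto intro: hex_points_separated)

lemma card_hex_packing: "card (hex_packing k) = (k + 1)\<^sup>2 + 1"
  unfolding hex_packing_def
  by (subst card_table_packing) (simp_all add: card_image inj_on_subset[OF inj_hex_point] power2_eq_square)

text \<open>Each index \<open>(i, j)\<close> with \<open>i, j < k\<close> contributes four pairs:
  one with the plane and three between lattice neighbours. Indices up to \<open>k\<close> are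
  present, so every endpoint exists.\<close>

lemma num_tangencies_hex: "num_tangencies (hex_packing k) \<ge> 4 * k\<^sup>2"
proof -
  define v where "v x = (case x of None \<Rightarrow> plane_horosphere 2
    | Some p \<Rightarrow> sphere_horosphere (hex_point p) 1)" for x
  \<comment> \<open>Pairs are coded by labels, with \<open>None\<close> for the plane, so that their
    distinctness is a combinatorial check: a pair determines its type \<open>c\<close> and then
    \<open>(i, j)\<close>.\<close>
  define e :: "nat \<times> nat \<times> nat \<Rightarrow> (nat \<times> nat) option set" where
    "e = (\<lambda>(c, i, j).
      if c = 0 then {None, Some (i, j)}
      else if c = 1 then {Some (i, j), Some (Suc i, j)}
      else if c = 2 then {Some (i, j), Some (i, Suc j)}
      else {Some (Suc i, j), Some (i, Suc j)})"
  let ?I = "{..<4 :: nat} \<times> {..<k} \<times> {..<k}"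
  let ?E = "{{S, T} |S T. S \<in> hex_packing k \<and> T \<in> hex_packing k \<and> S \<noteq> T \<and> tangent S T}"
  have v_None [simp]: "v None = plane_horosphere 2"
    and v_Some [simp]: "v (Some p) = sphere_horosphere (hex_point p) 1" for p
    by (simp_all add: v_def)
  have "inj v"
  proof (rule injI)
    fix x y assume "v x = v y"
    then show "x = y"
      using sphere_neq_plane[of 1 _ 2] sphere_neq_plane[of 1 _ 2, symmetric]
      by (cases x; cases y) (simp_all add: sphere_horosphere_eq_iff inj_eq[OF inj_hex_point])
  qed
  have "inj_on e ?I"
    by (rule inj_onI) (auto simp: e_def doubleton_eq_iff less_Suc_eq numeral_eq_Suc split: if_splits)
  then have "inj_on (\<lambda>x. v ` e x) ?I"
    using inj_image_eq_iff[OF \<open>inj v\<close>] by (simp add: inj_on_def)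
  moreover have "(\<lambda>x. v ` e x) ` ?I \<subseteq> ?E"
  proof (rule image_subsetI)
    fix x assume "x \<in> ?I"
    then obtain c i j where x: "x = (c, i, j)" "i < k" "j < k" by auto
    have edge: "v ` {y, z} \<in> ?E"
      if "y \<noteq> z" "v y \<in> hex_packing k" "v z \<in> hex_packing k" "tangent (v y) (v z)" for y z
    proof -
      have "v y \<noteq> v z" using that(1) inj_eq[OF \<open>inj v\<close>] by simp
      with that(2-4) show ?thesis
        unfolding image_insert image_empty by blast
    qed
    have None: "v None \<in> hex_packing k"
      by (simp add: hex_packing_def table_packing_def)
    have Some: "v (Some (a, b)) \<in> hex_packing k" if "a \<le> k" "b \<le> k" for a b
      using that by (simp add: hex_packing_def table_packing_def)
    have "tangent (v None) (v (Some (i, j)))"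
      by (subst tangent_commute) (simp add: tangent_sphere_plane_iff)
    moreover have "tangent (v (Some (i, j))) (v (Some (Suc i, j)))"
      "tangent (v (Some (i, j))) (v (Some (i, Suc j)))"
      "tangent (v (Some (Suc i, j))) (v (Some (i, Suc j)))"
      by (simp_all add: unit_spheres_tangent hex_points_adjacent)
    ultimately have edges: "v ` {None, Some (i, j)} \<in> ?E" "v ` {Some (i, j), Some (Suc i, j)} \<in> ?E"
      "v ` {Some (i, j), Some (i, Suc j)} \<in> ?E" "v ` {Some (Suc i, j), Some (i, Suc j)} \<in> ?E"
      using x(2,3) by (intro edge None Some; simp)+
    have "e x \<in> {{None, Some (i, j)}, {Some (i, j), Some (Suc i, j)},
        {Some (i, j), Some (i, Suc j)}, {Some (Suc i, j), Some (i, Suc j)}}"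
      by (simp add: e_def x(1))
    then show "v ` e x \<in> ?E"
      by (elim insertE emptyE) (simp_all only: edges)
  qed
  ultimately have "card ?I \<le> card ?E"
    using horosphere_packing_hex[of k]
    by (intro card_inj_on_le finite_tangencies) (auto simp: horosphere_packing_def)
  then show ?thesis
    by (simp add: num_tangencies_def power2_eq_square)
qed

section \<open>The maximal number of tangencies\<close>

lemma packing_imp_packed: "horosphere_packing P \<Longrightarrow> packed P"
  by (simp add: horosphere_packing_def packed_def)

text \<open>\<open>Max\<close> is meaningful only on finite sets. There may be infinitely many
  packings, but the bound \<open>5 * n\<close> leaves finitely many values.\<close>

lemma finite_tangency_numbers:
  "finite {num_tangencies P |P. horosphere_packing P \<and> card P = n}"
  by (rule finite_subset[of _ "{..5 * n}"]) (auto dest: packing_imp_packed num_tangencies_le)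

lemma num_tangencies_le_m_max:
  "horosphere_packing P \<Longrightarrow> num_tangencies P \<le> m_max (card P)"
  unfolding m_max_def by (intro Max_ge finite_tangency_numbers) blast

lemma m_max_le:
  assumes "n \<ge> 1"
  shows "m_max n \<le> 5 * n"
proof -
  obtain k where n: "n = Suc k" using assms by (cases n) auto
  \<comment> \<open>To bound \<open>Max\<close> from above its set must be nonempty; a row of
    \<open>n - 1\<close> unit spheres and the plane form a packing of size \<open>n\<close>.\<close>
  define A where "A = (\<lambda>i. hex_point (i, 0)) ` {..<k}"
  have "inj (\<lambda>i. hex_point (i, 0))"
    using inj_hex_point by (auto simp: inj_def)
  then have "card A = k"
    by (simp add: A_def card_image inj_on_subset)
  then have "card (table_packing A) = n"
    using card_table_packing[of A] by (simp add: n A_def)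
  moreover have "horosphere_packing (table_packing A)"
    by (rule horosphere_packing_table) (auto simp: A_def intro: hex_points_separated)
  ultimately have "{num_tangencies P |P. horosphere_packing P \<and> card P = n} \<noteq> {}"
    by blast
  moreover have "m \<le> 5 * n"
    if "m \<in> {num_tangencies P |P. horosphere_packing P \<and> card P = n}" for m
    using that num_tangencies_le[OF packing_imp_packed] by blast
  ultimately show ?thesis
    unfolding m_max_def by (intro Max.boundedI finite_tangency_numbers)
qed

theorem corollary1:
  "limsup (\<lambda>n. ereal (real (m_max n) / real n)) \<in> {4..5}"
proof -
  let ?f = "\<lambda>n. ereal (real (m_max n) / real n)"
  \<comment> \<open>The size of \<open>hex_packing k\<close>; the lower bound is obtained along this
    subsequence.\<close>
  define n where "n k = (k + 1)\<^sup>2 + 1" for k :: nat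
  have "eventually (\<lambda>n. ?f n \<le> 5) sequentially"
    using eventually_ge_at_top[of 1]
  proof eventually_elim
    case (elim n)
    then show ?case
      using m_max_le[OF elim] by (simp add: divide_le_eq flip: of_nat_mult)
  qed
  then have upper: "limsup ?f \<le> 5"
    by (rule Limsup_bounded)
  have mono: "strict_mono n"
    by (rule strict_monoI_Suc) (simp add: n_def power2_eq_square)
  \<comment> \<open>A simple minorant of \<open>4 k^2 / ((k + 1)^2 + 1)\<close> that tends to
    4.\<close>
  have le: "4 - 8 * inverse (real (Suc k)) \<le> real (m_max (n k)) / real (n k)" for k
  proof -
    define y where "y = real (Suc k)"
    have y: "y > 0" "real (n k) = y\<^sup>2 + 1" "real k = y - 1"
      by (simp_all add: y_def n_def add.commute)
    have "4 * k\<^sup>2 \<le> m_max (n k)"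
      using num_tangencies_le_m_max[OF horosphere_packing_hex[of k]] num_tangencies_hex[of k]
      unfolding card_hex_packing n_def by linarith
    then have "real (4 * k\<^sup>2) \<le> real (m_max (n k))"
      by (simp only: of_nat_le_iff)
    then have "4 * (y - 1)\<^sup>2 \<le> real (m_max (n k))"
      by (simp add: y(3))
    moreover have "(4 - 8 * inverse y) * (y\<^sup>2 + 1) = 4 * (y - 1)\<^sup>2 - 8 * inverse y"
      using y(1) by (simp add: power2_eq_square field_simps)
    moreover have "inverse y > 0" using y(1) by simp
    ultimately have "(4 - 8 * inverse y) * real (n k) \<le> real (m_max (n k))"
      unfolding y(2) by linarith
    moreover have "real (n k) > 0" unfolding y(2) by (simp add: add_nonneg_pos)
    ultimately show ?thesis
      unfolding y_def by (simp only: pos_le_divide_eq)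
  qed
  have "(\<lambda>k. 4 - 8 * inverse (real (Suc k))) \<longlonglongrightarrow> 4 - 8 * 0"
    by (intro tendsto_intros LIMSEQ_inverse_real_of_nat)
  then have "limsup (\<lambda>k. ereal (4 - 8 * inverse (real (Suc k)))) = 4"
    by (intro lim_imp_Limsup) simp_all
  moreover have "limsup (\<lambda>k. ereal (4 - 8 * inverse (real (Suc k)))) \<le> limsup (?f \<circ> n)"
    using le by (intro Limsup_mono always_eventually) simp
  moreover have "limsup (?f \<circ> n) \<le> limsup ?f"
    by (rule limsup_subseq_mono[OF mono])
  ultimately have "4 \<le> limsup ?f" by simp
  with upper show ?thesis by simp
qed

end
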